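(* Let $f\in\mathcal{LC}_n$. Then its coefficient function $S\mapsto f_S$ is log-submodular on the Boolean lattice; that is, for all $A,B\subseteq[n]$, $$f_{A\cup B}\,f_{A\cap B}\le f_A\,f_B .$$
   Context: $[n]=\{1,\dots,n\}$. The squarefree algebra $\mathcal{A}_n:=\mathbb{R}[t_1,\dots,t_n]/(t_1^2,\dots,t_n^2)$ has basis $\{t^S: S\subseteq[n]\}$ with $t^S:=\prod_{i\in S}t_i$, $t^\varnothing=1$; write $f=\sum_{S\subseteq[n]}f_S t^S$ with $f_S\in\mathbb{R}$. For $f\in\mathcal{A}_n$ with $f_\varnothing=1$, define $\log f:=\sum_{k=1}^n\frac{(-1)^{k+1}}{k}(f-1)^k=\sum_{\varnothing\ne S\subseteq[n]}\kappa_S(f)\,t^S$. $\mathcal{LC}_n$ is the set of $f\in\mathcal{A}_n$ with $f_S\ge0$ for all $S\subseteq[n]$, $f_\varnothing=1$, and $\kappa_S(f)\le0$ for all $S\subseteq[n]$ with $|S|\ge2$. *)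

theory Defs
  imports Complex_Main "HOL-Library.Poly_Mapping" "HOL-Algebra.QuotRing"
begin

text \<open>
  A monomial is its exponent vector, so a polynomial is a finitely supported map from exponent
  vectors to coefficients. The type has a variable for every natural number; the carrier
  admits only the variables with index in \<open>{1..n}\<close>.
\<close>

type_synonym real_mpoly = "(nat \<Rightarrow>\<^sub>0 nat) \<Rightarrow>\<^sub>0 real"

definition mpoly_ring :: "nat \<Rightarrow> real_mpoly ring" where
  "mpoly_ring n =
     \<lparr>carrier = {p. \<forall>m \<in> Poly_Mapping.keys p. Poly_Mapping.keys m \<subseteq> {1..n}},
      monoid.mult = (*), one = 1, zero = 0, add = (+)\<rparr>"

definition mpoly_var :: "nat \<Rightarrow> real_mpoly" where
  "mpoly_var i = Poly_Mapping.single (Poly_Mapping.single i 1) 1"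

definition mpoly_const :: "real \<Rightarrow> real_mpoly" where
  "mpoly_const c = Poly_Mapping.single 0 c"

definition sqfree_ideal :: "nat \<Rightarrow> real_mpoly set" where
  "sqfree_ideal n =
     Idl\<^bsub>mpoly_ring n\<^esub> ((\<lambda>i. mpoly_var i [^]\<^bsub>mpoly_ring n\<^esub> (2::nat)) ` {1..n})"

definition sqfree_algebra :: "nat \<Rightarrow> real_mpoly set ring" where
  "sqfree_algebra n = mpoly_ring n Quot sqfree_ideal n"

definition sqfree_class :: "nat \<Rightarrow> real_mpoly \<Rightarrow> real_mpoly set" where
  "sqfree_class n p = sqfree_ideal n +>\<^bsub>mpoly_ring n\<^esub> p"

text \<open>
  The real vector space structure on the quotient is multiplication by the class of a constant.
\<close>

definition sqfree_scale :: "nat \<Rightarrow> real \<Rightarrow> real_mpoly set \<Rightarrow> real_mpoly set" where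
  "sqfree_scale n c f = sqfree_class n (mpoly_const c) \<otimes>\<^bsub>sqfree_algebra n\<^esub> f"

definition sqfree_monom :: "nat \<Rightarrow> nat set \<Rightarrow> real_mpoly set" where
  "sqfree_monom n S = (\<Otimes>\<^bsub>sqfree_algebra n\<^esub>i\<in>S. sqfree_class n (mpoly_var i))"

text \<open>
  The coefficient \<open>f\<^sub>S\<close> of \<open>f\<close> with respect to the basis of squarefree monomials, set to 0
  when \<open>S\<close> is not a subset of \<open>{1..n}\<close>. Existence and uniqueness of the coefficient
  family are proved in \<open>sqfree_basis\<close> below.
\<close>

definition sqfree_expansion :: "nat \<Rightarrow> real_mpoly set \<Rightarrow> (nat set \<Rightarrow> real) \<Rightarrow> bool" where
  "sqfree_expansion n f c \<longleftrightarrow>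
     (\<forall>S. \<not> S \<subseteq> {1..n} \<longrightarrow> c S = 0) \<and>
     f = (\<Oplus>\<^bsub>sqfree_algebra n\<^esub>S\<in>Pow {1..n}. sqfree_scale n (c S) (sqfree_monom n S))"

definition sqfree_coeff :: "nat \<Rightarrow> real_mpoly set \<Rightarrow> nat set \<Rightarrow> real" where
  "sqfree_coeff n f = (THE c. sqfree_expansion n f c)"

definition sqfree_log :: "nat \<Rightarrow> real_mpoly set \<Rightarrow> real_mpoly set" where
  "sqfree_log n f =
     (\<Oplus>\<^bsub>sqfree_algebra n\<^esub>k\<in>{1..n}.
        sqfree_scale n ((-1) ^ (k + 1) / real k)
          ((f \<ominus>\<^bsub>sqfree_algebra n\<^esub> \<one>\<^bsub>sqfree_algebra n\<^esub>) [^]\<^bsub>sqfree_algebra n\<^esub> k))"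

definition cumulant :: "nat \<Rightarrow> nat set \<Rightarrow> real_mpoly set \<Rightarrow> real" where
  "cumulant n S f = sqfree_coeff n (sqfree_log n f) S"

definition LC :: "nat \<Rightarrow> real_mpoly set set" where
  "LC n = {f \<in> carrier (sqfree_algebra n).
     (\<forall>S. S \<subseteq> {1..n} \<longrightarrow> sqfree_coeff n f S \<ge> 0) \<and>
     sqfree_coeff n f {} = 1 \<and>
     (\<forall>S. S \<subseteq> {1..n} \<and> card S \<ge> 2 \<longrightarrow> cumulant n S f \<le> 0)}"

lemma mpoly_ring_simps:
  "carrier (mpoly_ring n) = {p. \<forall>m \<in> Poly_Mapping.keys p. Poly_Mapping.keys m \<subseteq> {1..n}}"
  "x \<otimes>\<^bsub>mpoly_ring n\<^esub> y = x * y" "\<one>\<^bsub>mpoly_ring n\<^esub> = 1"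
  "\<zero>\<^bsub>mpoly_ring n\<^esub> = 0" "x \<oplus>\<^bsub>mpoly_ring n\<^esub> y = x + y"
  by (simp_all add: mpoly_ring_def)

lemma mpoly_ring_mult_closed:
  assumes "x \<in> carrier (mpoly_ring n)" "y \<in> carrier (mpoly_ring n)"
  shows "x * y \<in> carrier (mpoly_ring n)"
  unfolding mpoly_ring_simps
proof (clarify)
  fix m i assume "m \<in> Poly_Mapping.keys (x * y)" and i: "i \<in> Poly_Mapping.keys m"
  then obtain a b where ab: "m = a + b" "a \<in> Poly_Mapping.keys x" "b \<in> Poly_Mapping.keys y"
    using keys_mult[of x y] by blast
  then have "i \<in> Poly_Mapping.keys a \<union> Poly_Mapping.keys b"
    using i keys_add[of a b] by blast
  with ab assms show "i \<in> {1..n}" unfolding mpoly_ring_simps by blast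
qed

lemma mpoly_ring_cring: "cring (mpoly_ring n)"
proof (rule cringI)
  show "abelian_group (mpoly_ring n)"
  proof (rule abelian_groupI)
    fix x y assume "x \<in> carrier (mpoly_ring n)" "y \<in> carrier (mpoly_ring n)"
    then show "x \<oplus>\<^bsub>mpoly_ring n\<^esub> y \<in> carrier (mpoly_ring n)"
      using Poly_Mapping.keys_add[of x y] unfolding mpoly_ring_simps by blast
  next
    fix x assume x: "x \<in> carrier (mpoly_ring n)"
    then have "- x \<in> carrier (mpoly_ring n)"
      by (simp add: mpoly_ring_simps in_keys_iff)
    then show "\<exists>y\<in>carrier (mpoly_ring n). y \<oplus>\<^bsub>mpoly_ring n\<^esub> x = \<zero>\<^bsub>mpoly_ring n\<^esub>"
      by (intro bexI[of _ "- x"]) (simp_all add: mpoly_ring_simps)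
  qed (simp_all add: mpoly_ring_simps add_ac)
  show "comm_monoid (mpoly_ring n)"
  proof (rule comm_monoidI)
    fix x y assume "x \<in> carrier (mpoly_ring n)" "y \<in> carrier (mpoly_ring n)"
    then show "x \<otimes>\<^bsub>mpoly_ring n\<^esub> y \<in> carrier (mpoly_ring n)"
      using mpoly_ring_mult_closed by (simp add: mpoly_ring_simps(2))
  qed (simp_all add: mpoly_ring_simps mult_ac)
qed (simp add: mpoly_ring_simps distrib_right)

lemma mpoly_var_closed: "i \<in> {1..n} \<Longrightarrow> mpoly_var i \<in> carrier (mpoly_ring n)"
  by (simp add: mpoly_ring_simps mpoly_var_def)

lemma mpoly_const_closed: "mpoly_const c \<in> carrier (mpoly_ring n)"
  by (simp add: mpoly_ring_simps mpoly_const_def)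

lemma mpoly_var_square:
  "mpoly_var i [^]\<^bsub>mpoly_ring n\<^esub> (2::nat) = Poly_Mapping.single (Poly_Mapping.single i 2) 1"
proof -
  interpret cring "mpoly_ring n" by (rule mpoly_ring_cring)
  have "mpoly_var i [^]\<^bsub>mpoly_ring n\<^esub> (2::nat) = mpoly_var i * mpoly_var i"
    by (simp add: numeral_2_eq_2 mpoly_ring_simps)
  also have "\<dots> = Poly_Mapping.single (Poly_Mapping.single i 1 + Poly_Mapping.single i 1) 1"
    unfolding mpoly_var_def mult_single by simp
  also have "Poly_Mapping.single i 1 + Poly_Mapping.single i 1 = Poly_Mapping.single i (2::nat)"
    unfolding single_add[symmetric] one_add_one ..
  finally show ?thesis .
qed

lemma sqfree_ideal_is_ideal: "ideal (sqfree_ideal n) (mpoly_ring n)"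
proof -
  interpret cring "mpoly_ring n" by (rule mpoly_ring_cring)
  show ?thesis unfolding sqfree_ideal_def
    by (rule genideal_ideal) (auto intro!: nat_pow_closed mpoly_var_closed)
qed

lemma sqfree_algebra_cring: "cring (sqfree_algebra n)"
  unfolding sqfree_algebra_def
  by (rule ideal.quotient_is_cring[OF sqfree_ideal_is_ideal mpoly_ring_cring])

lemma sqfree_class_hom: "sqfree_class n \<in> ring_hom (mpoly_ring n) (sqfree_algebra n)"
proof -
  have "sqfree_class n = (\<lambda>p. sqfree_ideal n +>\<^bsub>mpoly_ring n\<^esub> p)"
    by (simp add: sqfree_class_def fun_eq_iff)
  then show ?thesis unfolding sqfree_algebra_def
    using ideal.rcos_ring_hom[OF sqfree_ideal_is_ideal] by simp
qed

lemma sqfree_class_surj: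
  assumes "f \<in> carrier (sqfree_algebra n)"
  obtains p where "p \<in> carrier (mpoly_ring n)" "f = sqfree_class n p"
  using assms unfolding sqfree_algebra_def FactRing_simps sqfree_class_def by auto

definition sqfree_exp :: "nat set \<Rightarrow> nat \<Rightarrow>\<^sub>0 nat" where
  "sqfree_exp S = (\<Sum>i\<in>S. Poly_Mapping.single i 1)"

lemma lookup_sqfree_exp:
  "finite S \<Longrightarrow> Poly_Mapping.lookup (sqfree_exp S) i = (if i \<in> S then 1 else 0)"
  by (simp add: sqfree_exp_def lookup_sum lookup_single when_def)

lemma keys_sqfree_exp: "finite S \<Longrightarrow> Poly_Mapping.keys (sqfree_exp S) = S"
  by (auto simp: in_keys_iff lookup_sqfree_exp split: if_splits)

lemma sqfree_exp_inject:
  "finite S \<Longrightarrow> finite T \<Longrightarrow> sqfree_exp S = sqfree_exp T \<longleftrightarrow> S = T"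
  by (metis keys_sqfree_exp)

lemma le_one_sqfree_exp:
  assumes "\<And>i. Poly_Mapping.lookup m i \<le> 1"
  shows "m = sqfree_exp (Poly_Mapping.keys m)"
proof (rule poly_mapping_eqI)
  fix i show "Poly_Mapping.lookup m i = Poly_Mapping.lookup (sqfree_exp (Poly_Mapping.keys m)) i"
    using assms[of i] by (auto simp: lookup_sqfree_exp in_keys_iff)
qed

lemma sqfree_exp_summand:
  assumes "finite S" "sqfree_exp S = k + l"
  shows "l = sqfree_exp (Poly_Mapping.keys l)" "Poly_Mapping.keys l \<subseteq> S"
proof -
  have *: "Poly_Mapping.lookup l i \<le> (if i \<in> S then 1 else 0)" for i
    using arg_cong[OF assms(2), of "\<lambda>x. Poly_Mapping.lookup x i"] lookup_sqfree_exp[OF assms(1), of i]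
    by (simp add: lookup_add split: if_splits)
  show "l = sqfree_exp (Poly_Mapping.keys l)"
    by (rule le_one_sqfree_exp, rule order_trans[OF *]) simp
  show "Poly_Mapping.keys l \<subseteq> S"
    using * by (force simp: in_keys_iff split: if_splits)
qed

lemma sqfree_ideal_iff:
  "p \<in> sqfree_ideal n \<longleftrightarrow>
     p \<in> carrier (mpoly_ring n) \<and>
     (\<forall>S. S \<subseteq> {1..n} \<longrightarrow> Poly_Mapping.lookup p (sqfree_exp S) = 0)"
proof
  interpret R: cring "mpoly_ring n" by (rule mpoly_ring_cring)
  let ?J = "{p \<in> carrier (mpoly_ring n).
     \<forall>S. S \<subseteq> {1..n} \<longrightarrow> Poly_Mapping.lookup p (sqfree_exp S) = 0}"
  have mult: "Poly_Mapping.lookup (y * x) (sqfree_exp S) = 0"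
    if x: "x \<in> ?J" and S: "S \<subseteq> {1..n}" for x y S
  proof -
    have "finite S" using S finite_subset by blast
    have "(Poly_Mapping.lookup x q when sqfree_exp S = k + q) = 0" for k q
    proof (cases "sqfree_exp S = k + q")
      case True
      then have "Poly_Mapping.lookup x q = 0"
        using sqfree_exp_summand(1)[OF \<open>finite S\<close> True] x
          order_trans[OF sqfree_exp_summand(2)[OF \<open>finite S\<close> True] S] by auto
      then show ?thesis by simp
    qed simp
    then show ?thesis by (simp add: lookup_mult)
  qed
  have "ideal ?J (mpoly_ring n)"
  proof (rule idealI[OF R.ring_axioms])
    show "subgroup ?J (add_monoid (mpoly_ring n))"
    proof
      show "?J \<subseteq> carrier (add_monoid (mpoly_ring n))" by auto
    next
      fix x y assume "x \<in> ?J" "y \<in> ?J"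
      then show "x \<otimes>\<^bsub>add_monoid (mpoly_ring n)\<^esub> y \<in> ?J"
        using R.a_closed[of x y] by (simp add: mpoly_ring_simps(5) lookup_add)
    next
      show "\<one>\<^bsub>add_monoid (mpoly_ring n)\<^esub> \<in> ?J"
        using R.zero_closed by (simp add: mpoly_ring_simps(4))
    next
      fix x assume x: "x \<in> ?J"
      then have "\<ominus>\<^bsub>mpoly_ring n\<^esub> x = - x"
        using R.minus_equality[of "- x" x] by (simp add: mpoly_ring_simps in_keys_iff)
      then have "\<ominus>\<^bsub>mpoly_ring n\<^esub> x \<in> ?J"
        using x R.a_inv_closed[of x] by simp
      then show "inv\<^bsub>add_monoid (mpoly_ring n)\<^esub> x \<in> ?J"
        by (simp only: a_inv_def)
    qed
  next
    fix a x assume ax: "a \<in> ?J" "x \<in> carrier (mpoly_ring n)"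
    show "x \<otimes>\<^bsub>mpoly_ring n\<^esub> a \<in> ?J"
      using mult[OF ax(1)] ax R.m_closed[of x a] by (simp add: mpoly_ring_simps(2))
    then show "a \<otimes>\<^bsub>mpoly_ring n\<^esub> x \<in> ?J"
      by (simp add: mpoly_ring_simps(2) mult.commute)
  qed
  moreover have "(\<lambda>i. mpoly_var i [^]\<^bsub>mpoly_ring n\<^esub> (2::nat)) ` {1..n} \<subseteq> ?J"
  proof clarify
    fix i assume i: "i \<in> {1..n}"
    have "sqfree_exp S \<noteq> Poly_Mapping.single i 2" if "S \<subseteq> {1..n}" for S
    proof
      assume "sqfree_exp S = Poly_Mapping.single i 2"
      then have "Poly_Mapping.lookup (sqfree_exp S) i = 2" by simp
      moreover have "finite S" using that finite_subset by blast
      ultimately show False by (simp add: lookup_sqfree_exp split: if_splits)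
    qed
    then show "mpoly_var i [^]\<^bsub>mpoly_ring n\<^esub> (2::nat) \<in> carrier (mpoly_ring n) \<and>
      (\<forall>S. S \<subseteq> {1..n} \<longrightarrow>
         Poly_Mapping.lookup (mpoly_var i [^]\<^bsub>mpoly_ring n\<^esub> (2::nat)) (sqfree_exp S) = 0)"
      using R.nat_pow_closed[OF mpoly_var_closed[OF i], of 2]
      unfolding mpoly_var_square lookup_single when_def by metis
  qed
  ultimately have "sqfree_ideal n \<subseteq> ?J"
    unfolding sqfree_ideal_def by (rule R.genideal_minimal)
  then show "p \<in> sqfree_ideal n \<Longrightarrow> p \<in> carrier (mpoly_ring n) \<and>
     (\<forall>S. S \<subseteq> {1..n} \<longrightarrow> Poly_Mapping.lookup p (sqfree_exp S) = 0)" by blast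
next
  interpret R: cring "mpoly_ring n" by (rule mpoly_ring_cring)
  interpret I: ideal "sqfree_ideal n" "mpoly_ring n" by (rule sqfree_ideal_is_ideal)
  assume p: "p \<in> carrier (mpoly_ring n) \<and>
     (\<forall>S. S \<subseteq> {1..n} \<longrightarrow> Poly_Mapping.lookup p (sqfree_exp S) = 0)"
  have mon: "Poly_Mapping.single m c \<in> sqfree_ideal n"
    if m: "m \<in> Poly_Mapping.keys p" for m c
  proof -
    have sub: "Poly_Mapping.keys m \<subseteq> {1..n}" using p m by (simp add: mpoly_ring_simps)
    have "\<exists>i. \<not> Poly_Mapping.lookup m i \<le> 1"
    proof (rule ccontr)
      assume "\<nexists>i. \<not> Poly_Mapping.lookup m i \<le> 1"
      then have "m = sqfree_exp (Poly_Mapping.keys m)" by (intro le_one_sqfree_exp) blast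
      then have "Poly_Mapping.lookup p m = 0" using p sub by metis
      then show False using m by (simp add: in_keys_iff)
    qed
    then obtain i where "\<not> Poly_Mapping.lookup m i \<le> 1" ..
    then have i: "Poly_Mapping.lookup m i \<ge> 2" by simp
    then have "i \<in> {1..n}" using sub by (intro subsetD[OF sub]) (simp add: in_keys_iff)
    define r where "r = m - Poly_Mapping.single i 2"
    have r: "r + Poly_Mapping.single i 2 = m"
      using i unfolding r_def
      by (intro poly_mapping_eqI) (auto simp: lookup_add lookup_minus lookup_single when_def)
    have "Poly_Mapping.keys r \<subseteq> Poly_Mapping.keys m"
      by (auto simp: in_keys_iff r[symmetric] lookup_add)
    then have "Poly_Mapping.single r c \<in> carrier (mpoly_ring n)"
      using sub by (auto simp: mpoly_ring_simps)
    moreover have "mpoly_var i [^]\<^bsub>mpoly_ring n\<^esub> (2::nat) \<in> sqfree_ideal n"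
      unfolding sqfree_ideal_def using \<open>i \<in> {1..n}\<close>
      by (intro subsetD[OF R.genideal_self]) (auto intro!: R.nat_pow_closed mpoly_var_closed)
    ultimately have "Poly_Mapping.single r c * Poly_Mapping.single (Poly_Mapping.single i 2) 1
        \<in> sqfree_ideal n"
      using I.I_l_closed by (metis mpoly_ring_simps(2) mpoly_var_square)
    then show ?thesis by (simp add: mult_single r)
  qed
  have "(\<Sum>m\<in>K. Poly_Mapping.single m (Poly_Mapping.lookup p m)) \<in> sqfree_ideal n"
    if "K \<subseteq> Poly_Mapping.keys p" for K
    using finite_subset[OF that finite_keys] that
  proof (induction K rule: finite_induct)
    case empty
    then show ?case using I.zero_closed by (simp add: mpoly_ring_simps)
  next
    case (insert m K)
    then show ?case
      using I.a_closed[OF mon[of m]] by (simp add: mpoly_ring_simps)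
  qed
  moreover have "(\<Sum>m\<in>Poly_Mapping.keys p. Poly_Mapping.single m (Poly_Mapping.lookup p m)) = p"
    by (intro poly_mapping_eqI)
       (auto simp: lookup_sum lookup_single when_def in_keys_iff)
  ultimately show "p \<in> sqfree_ideal n" by (metis order_refl)
qed

lemma sqfree_class_eq_iff:
  assumes "p \<in> carrier (mpoly_ring n)" "q \<in> carrier (mpoly_ring n)"
  shows "sqfree_class n p = sqfree_class n q \<longleftrightarrow>
     (\<forall>S. S \<subseteq> {1..n} \<longrightarrow>
        Poly_Mapping.lookup p (sqfree_exp S) = Poly_Mapping.lookup q (sqfree_exp S))"
proof -
  interpret R: cring "mpoly_ring n" by (rule mpoly_ring_cring)
  have neg: "\<ominus>\<^bsub>mpoly_ring n\<^esub> q = - q"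
    using R.minus_equality[of "- q" q] assms(2) by (simp add: mpoly_ring_simps in_keys_iff)
  have eq: "p \<ominus>\<^bsub>mpoly_ring n\<^esub> q = p - q"
    by (simp add: a_minus_def neg mpoly_ring_simps)
  have "sqfree_class n p = sqfree_class n q \<longleftrightarrow> p \<ominus>\<^bsub>mpoly_ring n\<^esub> q \<in> sqfree_ideal n"
    unfolding sqfree_class_def
    using R.quotient_eq_iff_same_a_r_cos[OF sqfree_ideal_is_ideal assms] by simp
  then show ?thesis
    using R.minus_closed[OF assms] unfolding sqfree_ideal_iff eq by (simp add: lookup_minus)
qed

lemma sqfree_monom_class:
  assumes "S \<subseteq> {1..n}"
  shows "Poly_Mapping.single (sqfree_exp S) 1 \<in> carrier (mpoly_ring n)"
    and "sqfree_monom n S = sqfree_class n (Poly_Mapping.single (sqfree_exp S) 1)"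
proof -
  interpret A: cring "sqfree_algebra n" by (rule sqfree_algebra_cring)
  have closed: "Poly_Mapping.single (sqfree_exp T) 1 \<in> carrier (mpoly_ring n)" if "T \<subseteq> {1..n}" for T
    using that finite_subset[OF that] by (simp add: mpoly_ring_simps keys_sqfree_exp)
  then show "Poly_Mapping.single (sqfree_exp S) 1 \<in> carrier (mpoly_ring n)" using assms .
  have "finite S" using assms finite_subset by blast
  then show "sqfree_monom n S = sqfree_class n (Poly_Mapping.single (sqfree_exp S) 1)"
    using assms
  proof (induction S rule: finite_induct)
    case empty
    then show ?case
      using ring_hom_one[OF sqfree_class_hom] by (simp add: sqfree_monom_def sqfree_exp_def mpoly_ring_simps)
  next
    case (insert i S)
    have cl: "sqfree_class n (mpoly_var j) \<in> carrier (sqfree_algebra n)" if "j \<in> {1..n}" for j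
      using ring_hom_closed[OF sqfree_class_hom mpoly_var_closed[OF that]] .
    have "sqfree_monom n (insert i S) =
        sqfree_class n (mpoly_var i) \<otimes>\<^bsub>sqfree_algebra n\<^esub> sqfree_monom n S"
      unfolding sqfree_monom_def using insert cl by (intro A.finprod_insert) auto
    also have "\<dots> = sqfree_class n (mpoly_var i * Poly_Mapping.single (sqfree_exp S) 1)"
      using ring_hom_mult[OF sqfree_class_hom mpoly_var_closed[of i] closed[of S]] insert
      by (simp add: mpoly_ring_simps(2))
    also have "mpoly_var i * Poly_Mapping.single (sqfree_exp S) 1
        = Poly_Mapping.single (sqfree_exp (insert i S)) 1"
      using insert by (simp add: mpoly_var_def mult_single sqfree_exp_def)
    finally show ?case .
  qed
qed

lemma sqfree_sum_class:
  assumes "P \<subseteq> Pow {1..n}"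
  shows "(\<Sum>S\<in>P. Poly_Mapping.single (sqfree_exp S) (c S)) \<in> carrier (mpoly_ring n)"
    and "(\<Oplus>\<^bsub>sqfree_algebra n\<^esub>S\<in>P. sqfree_scale n (c S) (sqfree_monom n S)) =
         sqfree_class n (\<Sum>S\<in>P. Poly_Mapping.single (sqfree_exp S) (c S))"
proof -
  interpret R: cring "mpoly_ring n" by (rule mpoly_ring_cring)
  interpret A: cring "sqfree_algebra n" by (rule sqfree_algebra_cring)
  interpret h: ring_hom_cring "mpoly_ring n" "sqfree_algebra n" "sqfree_class n"
    by unfold_locales (rule sqfree_class_hom)
  have term_closed: "Poly_Mapping.single (sqfree_exp S) (c S) \<in> carrier (mpoly_ring n)"
    and term_class: "sqfree_scale n (c S) (sqfree_monom n S) =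
        sqfree_class n (Poly_Mapping.single (sqfree_exp S) (c S))" if "S \<subseteq> {1..n}" for S
  proof -
    have *: "mpoly_const (c S) \<otimes>\<^bsub>mpoly_ring n\<^esub> Poly_Mapping.single (sqfree_exp S) 1
        = Poly_Mapping.single (sqfree_exp S) (c S)"
      by (simp add: mpoly_ring_simps mpoly_const_def mult_single)
    show "Poly_Mapping.single (sqfree_exp S) (c S) \<in> carrier (mpoly_ring n)"
      using R.m_closed[OF mpoly_const_closed sqfree_monom_class(1)[OF that]] * by metis
    show "sqfree_scale n (c S) (sqfree_monom n S) =
        sqfree_class n (Poly_Mapping.single (sqfree_exp S) (c S))"
      unfolding sqfree_scale_def sqfree_monom_class(2)[OF that]
      using h.hom_mult[OF mpoly_const_closed sqfree_monom_class(1)[OF that]] * by metis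
  qed
  have "finite P" using assms by (rule finite_subset) simp
  then have "(\<Sum>S\<in>P. Poly_Mapping.single (sqfree_exp S) (c S)) \<in> carrier (mpoly_ring n) \<and>
    (\<Oplus>\<^bsub>sqfree_algebra n\<^esub>S\<in>P. sqfree_scale n (c S) (sqfree_monom n S)) =
         sqfree_class n (\<Sum>S\<in>P. Poly_Mapping.single (sqfree_exp S) (c S))"
    using assms
  proof (induction P rule: finite_induct)
    case empty
    then show ?case using R.zero_closed h.hom_zero by (simp add: mpoly_ring_simps(4))
  next
    case (insert S P)
    have S: "S \<subseteq> {1..n}" and P: "\<And>T. T \<in> P \<Longrightarrow> T \<subseteq> {1..n}" using insert.prems by auto
    have "(\<lambda>S. sqfree_scale n (c S) (sqfree_monom n S)) \<in> P \<rightarrow> carrier (sqfree_algebra n)"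
      using term_class[OF P] h.hom_closed[OF term_closed[OF P]] by simp
    moreover have "sqfree_scale n (c S) (sqfree_monom n S) \<in> carrier (sqfree_algebra n)"
      using term_class[OF S] h.hom_closed[OF term_closed[OF S]] by simp
    ultimately have "(\<Oplus>\<^bsub>sqfree_algebra n\<^esub>S\<in>insert S P. sqfree_scale n (c S) (sqfree_monom n S)) =
        sqfree_class n (Poly_Mapping.single (sqfree_exp S) (c S)) \<oplus>\<^bsub>sqfree_algebra n\<^esub>
        (\<Oplus>\<^bsub>sqfree_algebra n\<^esub>S\<in>P. sqfree_scale n (c S) (sqfree_monom n S))"
      using A.finsum_insert[OF insert.hyps] term_class[OF S] by simp
    moreover have "P \<subseteq> Pow {1..n}" using P by blast
    note IH = insert.IH[OF this]
    ultimately show ?case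
      unfolding sum.insert[OF insert.hyps]
      using R.a_closed[OF term_closed[OF S] conjunct1[OF IH]]
        h.hom_add[OF term_closed[OF S] conjunct1[OF IH]] conjunct2[OF IH]
      by (simp add: mpoly_ring_simps(5))
  qed
  then show "(\<Sum>S\<in>P. Poly_Mapping.single (sqfree_exp S) (c S)) \<in> carrier (mpoly_ring n)"
    and "(\<Oplus>\<^bsub>sqfree_algebra n\<^esub>S\<in>P. sqfree_scale n (c S) (sqfree_monom n S)) =
         sqfree_class n (\<Sum>S\<in>P. Poly_Mapping.single (sqfree_exp S) (c S))" by auto
qed

lemma sqfree_expansion_class_iff:
  assumes "p \<in> carrier (mpoly_ring n)"
  shows "sqfree_expansion n (sqfree_class n p) c \<longleftrightarrow>
    c = (\<lambda>S. if S \<subseteq> {1..n} then Poly_Mapping.lookup p (sqfree_exp S) else 0)"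
proof -
  have "Poly_Mapping.lookup (\<Sum>S\<in>Pow {1..n}. Poly_Mapping.single (sqfree_exp S) (c S)) (sqfree_exp T) = c T"
    if T: "T \<subseteq> {1..n}" for T
  proof -
    have "Poly_Mapping.lookup (\<Sum>S\<in>Pow {1..n}. Poly_Mapping.single (sqfree_exp S) (c S)) (sqfree_exp T)
      = (\<Sum>S\<in>Pow {1..n}. if S = T then c S else 0)"
      unfolding lookup_sum lookup_single when_def
    proof (rule sum.cong[OF refl])
      fix S assume "S \<in> Pow {1..n}"
      then have "finite S" "finite T" using T finite_subset by blast+
      then show "(if sqfree_exp S = sqfree_exp T then c S else 0) = (if S = T then c S else 0)"
        by (simp add: sqfree_exp_inject)
    qed
    then show ?thesis using T by (simp add: sum.delta)
  qed
  then show ?thesis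
    unfolding sqfree_expansion_def sqfree_sum_class(2)[OF order_refl]
      sqfree_class_eq_iff[OF assms sqfree_sum_class(1)[OF order_refl]]
    by (auto simp: fun_eq_iff)
qed

theorem sqfree_basis:
  assumes "f \<in> carrier (sqfree_algebra n)"
  shows "\<exists>!c. sqfree_expansion n f c"
proof -
  obtain p where "p \<in> carrier (mpoly_ring n)" "f = sqfree_class n p"
    using sqfree_class_surj[OF assms] .
  then show ?thesis by (simp only: sqfree_expansion_class_iff) blast
qed

lemma sqfree_coeff_class:
  assumes "p \<in> carrier (mpoly_ring n)" "S \<subseteq> {1..n}"
  shows "sqfree_coeff n (sqfree_class n p) S = Poly_Mapping.lookup p (sqfree_exp S)"
  using assms by (simp add: sqfree_coeff_def sqfree_expansion_class_iff)

end

theory Submission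
  imports Defs
begin

text \<open>
  Membership in \<open>\<L>\<C>\<close> passes to normalised links: since \<open>\<partial>\<^sub>i f = f \<cdot> \<partial>\<^sub>i log f\<close> with \<open>t\<^sub>i = 0\<close>, one has
  \<open>\<partial>\<^sub>i f / f\<^sub>i = f \<cdot> (1 - h)\<close> where \<open>h\<close> has coefficients \<open>- \<kappa>\<^sub>i\<^sub>T / f\<^sub>i \<ge> 0\<close>, and
  \<open>log (1 - h)\<close> has nonpositive coefficients. The same recursion gives \<open>f\<^sub>i\<^sub>S \<le> f\<^sub>i f\<^sub>S\<close>.
  Log-submodularity then follows by induction, taking the link of one element at a time.
\<close>

section \<open>Coefficients at squarefree monomials and subset convolution\<close>

text \<open>Residue classes are determined by these coefficients for \<open>S\<close> inside the
  ground set. Identities in the squarefree algebra thus become identities of \<open>sq_coeff\<close>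
  between ordinary polynomials, where type class ring arithmetic applies.\<close>

definition sq_coeff :: "real_mpoly \<Rightarrow> nat set \<Rightarrow> real" where
  "sq_coeff p S = Poly_Mapping.lookup p (sqfree_exp S)"

lemma sq_coeff_add [simp]: "sq_coeff (p + q) S = sq_coeff p S + sq_coeff q S"
  by (simp add: sq_coeff_def lookup_add)

lemma sq_coeff_minus [simp]: "sq_coeff (p - q) S = sq_coeff p S - sq_coeff q S"
  by (simp add: sq_coeff_def lookup_minus)

lemma sq_coeff_sum: "sq_coeff (\<Sum>x\<in>X. p x) S = (\<Sum>x\<in>X. sq_coeff (p x) S)"
  by (simp add: sq_coeff_def lookup_sum)

lemma sq_coeff_single:
  "finite S \<Longrightarrow> finite T \<Longrightarrow>
    sq_coeff (Poly_Mapping.single (sqfree_exp S) c) T = (if S = T then c else 0)"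
  by (simp add: sq_coeff_def lookup_single when_def sqfree_exp_inject)

lemma sq_coeff_one: "finite S \<Longrightarrow> sq_coeff 1 S = (if S = {} then 1 else 0)"
  using sq_coeff_single[of "{}" S 1] by (auto simp: sqfree_exp_def)

lemma sqfree_exp_add_Diff: "finite S \<Longrightarrow> T \<subseteq> S \<Longrightarrow> sqfree_exp T + sqfree_exp (S - T) = sqfree_exp S"
  unfolding sqfree_exp_def by (metis add.commute sum.subset_diff)

text \<open>Exponents add without cancellation, so an exponent vector with entries at most 1 splits
  only into the indicator vectors of two complementary subsets.\<close>

lemma sq_coeff_mult:
  assumes "finite S"
  shows "sq_coeff (p * q) S = (\<Sum>T\<in>Pow S. sq_coeff p T * sq_coeff q (S - T))"
proof -
  let ?c = "\<lambda>l. Poly_Mapping.lookup p l * (\<Sum>r. Poly_Mapping.lookup q r when sqfree_exp S = l + r)"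
  have inj: "inj_on sqfree_exp (Pow S)"
    using assms by (intro inj_onI) (metis PowD finite_subset sqfree_exp_inject)
  have c: "?c (sqfree_exp T) = sq_coeff p T * sq_coeff q (S - T)" if "T \<subseteq> S" for T
  proof -
    have "(sqfree_exp S = sqfree_exp T + r) = (r = sqfree_exp (S - T))" for r
      using sqfree_exp_add_Diff[OF assms that] by (metis add_left_cancel)
    then show ?thesis by (simp add: sq_coeff_def)
  qed
  have "{l. ?c l \<noteq> 0} \<subseteq> sqfree_exp ` Pow S"
  proof (clarify)
    fix l assume "?c l \<noteq> 0"
    then have "(\<Sum>r. Poly_Mapping.lookup q r when sqfree_exp S = l + r) \<noteq> 0" by simp
    then obtain r where "(Poly_Mapping.lookup q r when sqfree_exp S = l + r) \<noteq> 0"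
      by (rule Sum_any.not_neutral_obtains_not_neutral)
    then have "sqfree_exp S = l + r" by simp
    \<comment> \<open>\<open>sqfree_exp_summand\<close> describes the second summand, hence the
      swap.\<close>
    then have "sqfree_exp S = r + l" by (simp add: add.commute)
    from sqfree_exp_summand[OF assms this] show "l \<in> sqfree_exp ` Pow S" by blast
  qed
  then have "sq_coeff (p * q) S = sum ?c (sqfree_exp ` Pow S)"
    unfolding sq_coeff_def lookup_mult using assms by (intro Sum_any.expand_superset) auto
  also have "\<dots> = (\<Sum>T\<in>Pow S. sq_coeff p T * sq_coeff q (S - T))"
    using c by (simp add: sum.reindex[OF inj])
  finally show ?thesis .
qed

lemma mpoly_const_mult: "mpoly_const a * mpoly_const b = mpoly_const (a * b)"
  by (simp add: mpoly_const_def mult_single)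

lemma sq_coeff_const_mult: "sq_coeff (mpoly_const c * p) S = c * sq_coeff p S"
  unfolding sq_coeff_def mpoly_const_def by (simp add: lookup_mult lookup_single when_mult)

text \<open>A product's coefficient at \<open>S\<close> sees only coefficients at subsets of
  \<open>S\<close>. This takes the place of rewriting modulo the squares of the variables.\<close>

lemma sq_coeff_mult_cong:
  assumes "finite N" "S \<subseteq> N"
    and "\<And>T. T \<subseteq> N \<Longrightarrow> sq_coeff p T = sq_coeff p' T"
    and "\<And>T. T \<subseteq> N \<Longrightarrow> sq_coeff q T = sq_coeff q' T"
  shows "sq_coeff (p * q) S = sq_coeff (p' * q') S"
proof -
  have "finite S" using assms finite_subset by blast
  moreover have "T \<subseteq> N" "S - T \<subseteq> N" if "T \<in> Pow S" for T using that assms(2) by auto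
  ultimately show ?thesis using assms(3,4) by (simp add: sq_coeff_mult)
qed

text \<open>Orders of vanishing add: if \<open>T\<close> and \<open>S - T\<close> have fewer than
  \<open>a + b\<close> elements together, one of them falls below its bound.\<close>

lemma sq_coeff_mult_eq_0:
  assumes "finite S" "card S < a + b"
    and "\<And>T. finite T \<Longrightarrow> card T < a \<Longrightarrow> sq_coeff p T = 0"
    and "\<And>T. finite T \<Longrightarrow> card T < b \<Longrightarrow> sq_coeff q T = 0"
  shows "sq_coeff (p * q) S = 0"
proof -
  have "sq_coeff p T * sq_coeff q (S - T) = 0" if "T \<in> Pow S" for T
  proof -
    have "finite T" using that assms(1) finite_subset by auto
    moreover have "card (S - T) = card S - card T" "card T \<le> card S"
      using that assms(1) calculation by (auto simp: card_Diff_subset card_mono)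
    then have "card T < a \<or> card (S - T) < b" using assms(2) by linarith
    ultimately show ?thesis using assms by auto
  qed
  then show ?thesis using assms(1) by (simp add: sq_coeff_mult sum.neutral)
qed

lemma sq_coeff_power_eq_0:
  assumes "sq_coeff u {} = 0" "finite S" "card S < k"
  shows "sq_coeff (u ^ k) S = 0"
  using assms(2,3)
proof (induction k arbitrary: S)
  case (Suc k)
  show ?case unfolding power_Suc
    by (rule sq_coeff_mult_eq_0[of _ 1 k]) (use Suc assms(1) in auto)
qed simp

lemma sq_coeff_power_nonneg:
  assumes "\<And>S. finite S \<Longrightarrow> sq_coeff u S \<ge> 0" "finite S"
  shows "sq_coeff (u ^ k) S \<ge> 0"
  using assms(2)
proof (induction k arbitrary: S)
  case (Suc k)
  have "sq_coeff u T * sq_coeff (u ^ k) (S - T) \<ge> 0" if "T \<in> Pow S" for T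
    using that Suc assms(1)[of T] finite_subset[of T S] by auto
  then show ?case unfolding power_Suc sq_coeff_mult[OF Suc.prems] by (rule sum_nonneg)
qed (simp add: sq_coeff_one)

text \<open>Realises prescribed coefficients by a polynomial; the link construction needs this for
  its second factor.\<close>

definition sq_poly :: "nat set \<Rightarrow> (nat set \<Rightarrow> real) \<Rightarrow> real_mpoly" where
  "sq_poly N c = (\<Sum>S\<in>Pow N. Poly_Mapping.single (sqfree_exp S) (c S))"

lemma sq_coeff_sq_poly:
  assumes "finite N" "finite S"
  shows "sq_coeff (sq_poly N c) S = (if S \<subseteq> N then c S else 0)"
proof -
  have "sq_coeff (sq_poly N c) S = (\<Sum>T\<in>Pow N. if T = S then c T else 0)"
    unfolding sq_poly_def sq_coeff_sum
  proof (intro sum.cong refl)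
    fix T assume "T \<in> Pow N"
    then have "finite T" using assms(1) finite_subset by blast
    then show "sq_coeff (Poly_Mapping.single (sqfree_exp T) (c T)) S = (if T = S then c T else 0)"
      using assms(2) by (simp add: sq_coeff_single)
  qed
  then show ?thesis using assms by (simp add: sum.delta)
qed

section \<open>Euler operators as derivations\<close>

text \<open>
  The partial derivative \<open>\<partial>\<^sub>j\<close> does not descend to the squarefree algebra, but the
  Euler operator \<open>t\<^sub>j \<partial>\<^sub>j\<close> does, and it stays a derivation there.
\<close>

definition euler :: "nat \<Rightarrow> real_mpoly \<Rightarrow> real_mpoly" where
  "euler j p = Poly_Mapping.mapp (\<lambda>m c. real (Poly_Mapping.lookup m j) * c) p"

lemma lookup_euler:
  "Poly_Mapping.lookup (euler j p) m = real (Poly_Mapping.lookup m j) * Poly_Mapping.lookup p m"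
  by (simp add: euler_def lookup_mapp when_def in_keys_iff)

lemma sq_coeff_euler:
  "finite S \<Longrightarrow> sq_coeff (euler j p) S = (if j \<in> S then sq_coeff p S else 0)"
  by (simp add: sq_coeff_def lookup_euler lookup_sqfree_exp)

lemma euler_add: "euler j (p + q) = euler j p + euler j q"
  by (rule poly_mapping_eqI) (simp add: lookup_euler lookup_add algebra_simps)

lemma euler_sum: "euler j (\<Sum>x\<in>X. p x) = (\<Sum>x\<in>X. euler j (p x))"
  by (rule poly_mapping_eqI) (simp add: lookup_euler lookup_sum sum_distrib_left)

lemma euler_single:
  "euler j (Poly_Mapping.single m c) = Poly_Mapping.single m (real (Poly_Mapping.lookup m j) * c)"
  by (rule poly_mapping_eqI) (simp add: lookup_euler lookup_single when_def)

text \<open>For two monomials this is additivity of exponents. Both sides are bilinear, so expanding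
  first \<open>q\<close> and then \<open>p\<close> into monomials gives the general case.\<close>

lemma euler_mult: "euler j (p * q) = euler j p * q + p * euler j q"
proof -
  have sum_single: "(\<Sum>m\<in>Poly_Mapping.keys r. Poly_Mapping.single m (Poly_Mapping.lookup r m)) = r"
    for r :: real_mpoly
    by (intro poly_mapping_eqI) (auto simp: lookup_sum lookup_single when_def in_keys_iff)
  have mono: "euler j (Poly_Mapping.single a c * Poly_Mapping.single b d) =
      euler j (Poly_Mapping.single a c) * Poly_Mapping.single b d +
      Poly_Mapping.single a c * euler j (Poly_Mapping.single b d)" for a b c d
    by (simp add: mult_single euler_single lookup_add algebra_simps flip: single_add)
  have right: "euler j (Poly_Mapping.single a c * q) =
      euler j (Poly_Mapping.single a c) * q + Poly_Mapping.single a c * euler j q" for a c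
    by (subst (1 2 3) sum_single[of q, symmetric])
       (simp add: sum_distrib_left euler_sum mono sum.distrib)
  show ?thesis
    by (subst (1 2 3) sum_single[of p, symmetric])
       (simp add: sum_distrib_right euler_sum right sum.distrib)
qed

lemma euler_power: "euler j (p ^ Suc k) = mpoly_const (real (Suc k)) * p ^ k * euler j p"
proof (induction k)
  case 0
  then show ?case by (simp add: mpoly_const_def)
next
  case (Suc k)
  have "mpoly_const (real (Suc (Suc k))) = 1 + mpoly_const (real (Suc k))"
    unfolding mpoly_const_def single_one[symmetric] single_add[symmetric] by simp
  then show ?case
    unfolding power_Suc[of p "Suc k"] euler_mult Suc by (simp add: algebra_simps)
qed

lemma euler_const_mult: "euler j (mpoly_const c * p) = mpoly_const c * euler j p"
  by (simp add: euler_mult) (simp add: mpoly_const_def euler_single)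

section \<open>The truncated logarithm: its derivative and its signs\<close>

text \<open>The series of log(1 + u), cut off after the power \<open>n\<close>; at u = f - 1 it is
  the polynomial counterpart of \<open>sqfree_log\<close>.\<close>

definition log_poly :: "nat \<Rightarrow> real_mpoly \<Rightarrow> real_mpoly" where
  "log_poly n u = (\<Sum>k\<in>{1..n}. mpoly_const ((-1) ^ (k + 1) / real k) * u ^ k)"

text \<open>The factor from differentiating each power cancels its denominator, which leaves the
  truncated geometric series of 1/(1 + u).\<close>

lemma euler_log_poly: "euler j (log_poly n u) = (\<Sum>k<n. (- u) ^ k) * euler j u"
proof -
  have "euler j (mpoly_const ((-1) ^ (Suc k + 1) / real (Suc k)) * u ^ Suc k) = (- u) ^ k * euler j u" for k
  proof -
    have "mpoly_const ((-1) ^ (Suc k + 1) / real (Suc k)) * mpoly_const (real (Suc k)) = mpoly_const ((-1) ^ k)"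
      by (simp add: mpoly_const_mult del: of_nat_Suc)
    also have "\<dots> = (-1) ^ k"
      by (cases "even k") (simp_all add: mpoly_const_def single_uminus)
    finally show ?thesis
      unfolding euler_const_mult euler_power power_minus[of u] by (simp only: mult.assoc[symmetric])
  qed
  then show ?thesis
    unfolding log_poly_def euler_sum sum_distrib_right
    by (simp add: sum.atLeast1_atMost_eq del: power_Suc of_nat_Suc)
qed

text \<open>The logarithmic derivative survives truncation: multiplication by \<open>1 + u\<close>
  telescopes the geometric sum, and the remainder only reaches sets with more than \<open>n\<close>
  elements.\<close>

lemma sq_coeff_euler_log_poly:
  assumes "sq_coeff u {} = 0" "finite S" "card S \<le> n"
  shows "sq_coeff ((1 + u) * euler j (log_poly n u)) S = sq_coeff (euler j u) S"
proof -
  have "(1 + u) * euler j (log_poly n u) = (1 - (- u) ^ n) * euler j u"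
    unfolding euler_log_poly one_diff_power_eq by simp
  also have "\<dots> = euler j u - (- u) ^ n * euler j u" by (simp add: algebra_simps)
  finally have *: "(1 + u) * euler j (log_poly n u) = euler j u - (- u) ^ n * euler j u" .
  have "sq_coeff (- u) {} = 0" using assms(1) by (simp add: sq_coeff_def)
  \<comment> \<open>The power contributes order \<open>n\<close>, and \<open>euler j u\<close>,
    having no constant term, one more; that extra one covers \<open>card S = n\<close>.\<close>
  then have "sq_coeff ((- u) ^ n * euler j u) S = 0"
    using assms by (intro sq_coeff_mult_eq_0[of _ n 1] sq_coeff_power_eq_0) (auto simp: sq_coeff_euler)
  then show ?thesis unfolding * by simp
qed

text \<open>Each term of the series is -(-u)^k / k, and powers of \<open>- u\<close> inherit its
  nonnegative coefficients.\<close>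

lemma sq_coeff_log_poly_nonpos:
  assumes "\<And>T. finite T \<Longrightarrow> sq_coeff u T \<le> 0" "finite S"
  shows "sq_coeff (log_poly n u) S \<le> 0"
proof -
  have "(-1) ^ (k + 1) / real k * sq_coeff (u ^ k) S \<le> 0" for k
  proof -
    have "sq_coeff ((- u) ^ k) S \<ge> 0"
      using assms by (intro sq_coeff_power_nonneg) (auto simp: sq_coeff_def)
    moreover have "sq_coeff ((- u) ^ k) S = (-1) ^ k * sq_coeff (u ^ k) S"
      by (cases "even k") (simp_all add: sq_coeff_def)
    ultimately show ?thesis by (simp add: divide_nonneg_nonneg)
  qed
  then show ?thesis
    unfolding log_poly_def sq_coeff_sum sq_coeff_const_mult by (intro sum_nonpos) simp
qed

section \<open>Coefficient functions on a finite ground set and their links\<close>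

text \<open>
  All that is needed of \<open>k = log f\<close> is \<open>t\<^sub>j \<partial>\<^sub>j f = f \<cdot> t\<^sub>j \<partial>\<^sub>j k\<close> on the squarefree
  coefficients.
\<close>

definition lc_log :: "nat set \<Rightarrow> (nat set \<Rightarrow> real) \<Rightarrow> real_mpoly \<Rightarrow> real_mpoly \<Rightarrow> bool" where
  "lc_log N c f k \<longleftrightarrow> finite N \<and> c {} = 1 \<and> (\<forall>S\<subseteq>N. c S \<ge> 0) \<and>
     (\<forall>S\<subseteq>N. sq_coeff f S = c S) \<and>
     (\<forall>j. \<forall>S\<subseteq>N. sq_coeff (euler j f) S = sq_coeff (f * euler j k) S) \<and>
     (\<forall>S\<subseteq>N. card S \<ge> 2 \<longrightarrow> sq_coeff k S \<le> 0)"

text \<open>With both polynomials hidden, the inductions below carry only the ground set and the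
  coefficient function, while passing to a link may replace both witnesses.\<close>

definition lc_on :: "nat set \<Rightarrow> (nat set \<Rightarrow> real) \<Rightarrow> bool" where
  "lc_on N c \<longleftrightarrow> (\<exists>f k. lc_log N c f k)"

lemma lc_onD:
  assumes "lc_on N c"
  shows "finite N" "c {} = 1" "S \<subseteq> N \<Longrightarrow> c S \<ge> 0"
  using assms unfolding lc_on_def lc_log_def by blast+

text \<open>The moment-cumulant recursion at \<open>i\<close>: in the convolution of
  \<open>f\<close> with \<open>euler i k\<close> only sets containing \<open>i\<close> survive, and
  these are indexed by their remaining elements \<open>T\<close>.\<close>

lemma sq_coeff_insert:
  assumes "finite S" "i \<notin> S"
    and "sq_coeff (euler i f) (insert i S) = sq_coeff (f * euler i k) (insert i S)"
  shows "sq_coeff f (insert i S) = (\<Sum>T\<in>Pow S. sq_coeff f (S - T) * sq_coeff k (insert i T))"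
proof -
  have "sq_coeff f (insert i S) =
      (\<Sum>T\<in>Pow (insert i S). sq_coeff (euler i k) T * sq_coeff f (insert i S - T))"
    using assms(1,3) sq_coeff_mult[of "insert i S" "euler i k" f]
    by (simp add: sq_coeff_euler mult.commute)
  also have "\<dots> = (\<Sum>T\<in>insert i ` Pow S. sq_coeff (euler i k) T * sq_coeff f (insert i S - T))"
  proof (rule sum.mono_neutral_right)
    show "\<forall>T\<in>Pow (insert i S) - insert i ` Pow S.
        sq_coeff (euler i k) T * sq_coeff f (insert i S - T) = 0"
    proof
      fix T assume T: "T \<in> Pow (insert i S) - insert i ` Pow S"
      then have "i \<notin> T" by (auto simp: Pow_insert)
      moreover have "finite T" using T assms(1) finite_subset[of T "insert i S"] by auto
      ultimately show "sq_coeff (euler i k) T * sq_coeff f (insert i S - T) = 0"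
        by (simp add: sq_coeff_euler)
    qed
  qed (use assms in auto)
  also have "\<dots> = (\<Sum>T\<in>Pow S. sq_coeff f (S - T) * sq_coeff k (insert i T))"
  proof (subst sum.reindex)
    show "inj_on (insert i) (Pow S)" using assms(2) by (auto intro!: inj_onI)
  next
    show "sum ((\<lambda>T. sq_coeff (euler i k) T * sq_coeff f (insert i S - T)) \<circ> insert i) (Pow S) =
        (\<Sum>T\<in>Pow S. sq_coeff f (S - T) * sq_coeff k (insert i T))"
    proof (rule sum.cong[OF refl])
      fix T assume T: "T \<in> Pow S"
      then have "finite T" "insert i S - insert i T = S - T"
        using assms(1,2) finite_subset by auto
      then show "((\<lambda>T. sq_coeff (euler i k) T * sq_coeff f (insert i S - T)) \<circ> insert i) T =
          sq_coeff f (S - T) * sq_coeff k (insert i T)"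
        by (simp add: sq_coeff_euler)
    qed
  qed
  finally show ?thesis .
qed

lemma lc_logD:
  assumes "lc_log N c f k"
  shows "S \<subseteq> N \<Longrightarrow> sq_coeff f S = c S"
    and "S \<subseteq> N \<Longrightarrow> sq_coeff (euler j f) S = sq_coeff (f * euler j k) S"
    and "S \<subseteq> N \<Longrightarrow> card S \<ge> 2 \<Longrightarrow> sq_coeff k S \<le> 0"
    and "i \<in> N \<Longrightarrow> sq_coeff k {i} = c {i}"
proof -
  show f: "S \<subseteq> N \<Longrightarrow> sq_coeff f S = c S"
    and eq: "S \<subseteq> N \<Longrightarrow> sq_coeff (euler j f) S = sq_coeff (f * euler j k) S"
    and "S \<subseteq> N \<Longrightarrow> card S \<ge> 2 \<Longrightarrow> sq_coeff k S \<le> 0" for S j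
    using assms unfolding lc_log_def by blast+
  show "sq_coeff k {i} = c {i}" if i: "i \<in> N"
  proof -
    have "c {} = 1" using assms by (simp add: lc_log_def)
    \<comment> \<open>Over the empty set the recursion has a single term, so the first cumulant is
      the coefficient itself.\<close>
    moreover have "sq_coeff f {i} = sq_coeff f {} * sq_coeff k {i}"
      using sq_coeff_insert[of "{}" i f k] eq[of "{i}" i] i by simp
    ultimately show ?thesis using f[of "{i}"] f[of "{}"] i by simp
  qed
qed

text \<open>In the recursion the term \<open>T = {}\<close> is the right-hand side; every other term
  is a nonnegative coefficient times a cumulant of order at least 2, hence nonpositive.\<close>

lemma lc_on_insert_le:
  assumes "lc_on N c" "insert i S \<subseteq> N" "i \<notin> S"
  shows "c (insert i S) \<le> c {i} * c S"
proof -
  obtain f k where fk: "lc_log N c f k" using assms(1) unfolding lc_on_def by blast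
  note c = lc_onD[OF assms(1)] and f = lc_logD(1)[OF fk] and eq = lc_logD(2)[OF fk]
    and k = lc_logD(3)[OF fk] and c1 = lc_logD(4)[OF fk]
  have fin: "finite S" using assms(2) c(1) finite_subset by auto
  have ki: "sq_coeff k {i} = c {i}" using c1 assms(2) by simp
  have "c (insert i S) = (\<Sum>T\<in>Pow S. sq_coeff f (S - T) * sq_coeff k (insert i T))"
    using sq_coeff_insert[OF fin assms(3) eq] f assms(2) by simp
  also have "\<dots> \<le> (\<Sum>T\<in>Pow S. if T = {} then c {i} * c S else 0)"
  proof (rule sum_mono)
    fix T assume T: "T \<in> Pow S"
    have "S \<subseteq> N" "S - T \<subseteq> N" "insert i T \<subseteq> N" using T assms(2) by auto
    moreover have "card (insert i T) \<ge> 2" if "T \<noteq> {}"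
    proof -
      have "finite T" using T fin finite_subset by blast
      moreover have "i \<notin> T" using T assms(3) by blast
      ultimately show ?thesis using that card_gt_0_iff[of T] by (simp add: Suc_le_eq)
    qed
    ultimately show "sq_coeff f (S - T) * sq_coeff k (insert i T) \<le> (if T = {} then c {i} * c S else 0)"
      using f k c(3) ki by (simp add: mult_nonneg_nonpos)
  qed
  also have "\<dots> = c {i} * c S" using fin by (simp add: sum.delta)
  finally show ?thesis .
qed

text \<open>The link is represented by \<open>f * (1 + u)\<close>, so its logarithm is
  \<open>k + l\<close> with \<open>l\<close> that of \<open>1 + u\<close>. As \<open>u\<close> has
  nonpositive coefficients, so does \<open>l\<close>.\<close>

lemma lc_on_link:
  assumes "lc_on N c" "i \<in> N" "c {i} > 0"
  shows "lc_on (N - {i}) (\<lambda>S. c (insert i S) / c {i})"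
proof -
  obtain f k where fk: "lc_log N c f k" using assms(1) unfolding lc_on_def by blast
  note c = lc_onD[OF assms(1)] and f = lc_logD(1)[OF fk] and eq = lc_logD(2)[OF fk]
    and k = lc_logD(3)[OF fk] and c1 = lc_logD(4)[OF fk]
  have ki: "sq_coeff k {i} = c {i}" using c1 assms(2) by simp
  define M where "M = N - {i}"
  have M: "finite M" "M \<subseteq> N" "i \<notin> M" using c(1) by (auto simp: M_def)
  have finM: "finite S" if "S \<subseteq> M" for S using that M(1) finite_subset by blast
  have ins: "insert i S \<subseteq> N" if "S \<subseteq> M" for S using that M(2) assms(2) by blast
  \<comment> \<open>This is -h. The recursion divided by \<open>c {i}\<close> calls for the factors
    \<open>sq_coeff k (insert i T) / c {i}\<close>; at \<open>T = {}\<close> this is 1, which the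
    summand 1 in \<open>1 + u\<close> supplies, so \<open>u\<close> gets 0 there.\<close>
  define u where "u = sq_poly M (\<lambda>T. if T = {} then 0 else sq_coeff k (insert i T) / c {i})"
  \<comment> \<open>Truncation at \<open>card M\<close> loses nothing, since only coefficients at
    subsets of \<open>M\<close> are inspected.\<close>
  define l where "l = log_poly (card M) u"
  have u0: "sq_coeff u {} = 0" using M(1) by (simp add: u_def sq_coeff_sq_poly)
  have u_nonpos: "sq_coeff u T \<le> 0" if "finite T" for T
  proof -
    have "card (insert i T) \<ge> 2" if "T \<noteq> {}" "T \<subseteq> M"
    proof -
      have "i \<notin> T" using that M(3) by blast
      then show ?thesis using that \<open>finite T\<close> card_gt_0_iff[of T] by (simp add: Suc_le_eq)
    qed
    then show ?thesis
      using that M(1) ins[of T] k[of "insert i T"] assms(3)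
      by (auto simp: u_def sq_coeff_sq_poly divide_nonpos_pos)
  qed
  have u1: "sq_coeff (1 + u) T = sq_coeff k (insert i T) / c {i}" if "T \<subseteq> M" for T
    using that M(1) finM[OF that] ki assms(3) by (simp add: u_def sq_coeff_sq_poly sq_coeff_one)
  have g: "sq_coeff (f * (1 + u)) S = c (insert i S) / c {i}" if S: "S \<subseteq> M" for S
  proof -
    have "i \<notin> S" using S M(3) by blast
    have "sq_coeff (f * (1 + u)) S = (\<Sum>T\<in>Pow S. sq_coeff (1 + u) T * sq_coeff f (S - T))"
      unfolding mult.commute[of f] by (rule sq_coeff_mult[OF finM[OF S]])
    also have "\<dots> = (\<Sum>T\<in>Pow S. sq_coeff f (S - T) * sq_coeff k (insert i T)) / c {i}"
      unfolding sum_divide_distrib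
    proof (rule sum.cong[OF refl])
      fix T assume "T \<in> Pow S"
      then have "T \<subseteq> M" using S by blast
      then show "sq_coeff (1 + u) T * sq_coeff f (S - T) = sq_coeff f (S - T) * sq_coeff k (insert i T) / c {i}"
        unfolding u1[OF \<open>T \<subseteq> M\<close>] by simp
    qed
    also have "\<dots> = c (insert i S) / c {i}"
      using sq_coeff_insert[OF finM[OF S] \<open>i \<notin> S\<close> eq[OF ins[OF S]]] f[OF ins[OF S]] by simp
    finally show ?thesis .
  qed
  have geq: "sq_coeff (euler j (f * (1 + u))) S = sq_coeff ((f * (1 + u)) * euler j (k + l)) S"
    if S: "S \<subseteq> M" for j S
  proof -
    have "euler j (1 :: real_mpoly) = 0"
      by (rule poly_mapping_eqI) (auto simp: lookup_euler lookup_one when_def)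
    then have "sq_coeff (euler j (f * (1 + u))) S =
        sq_coeff (euler j f * (1 + u)) S + sq_coeff (f * euler j u) S"
      by (simp add: euler_mult euler_add)
    \<comment> \<open>The derivative identities for \<open>k\<close> and \<open>l\<close> hold only
      for coefficients inside \<open>M\<close>, so they enter each product through
      \<open>sq_coeff_mult_cong\<close>.\<close>
    also have "sq_coeff (euler j f * (1 + u)) S = sq_coeff ((f * euler j k) * (1 + u)) S"
      by (rule sq_coeff_mult_cong[OF M(1) S]) (use eq M(2) in auto)
    also have "sq_coeff (f * euler j u) S = sq_coeff (f * ((1 + u) * euler j l)) S"
      using sq_coeff_euler_log_poly[OF u0 finM, of _ "card M" j] M(1)
      by (intro sq_coeff_mult_cong[OF M(1) S]) (auto simp: l_def card_mono)
    finally show ?thesis by (simp add: euler_add algebra_simps flip: sq_coeff_add)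
  qed
  have "sq_coeff (k + l) S \<le> 0" if "S \<subseteq> M" "card S \<ge> 2" for S
    using k[of S] that M(2) sq_coeff_log_poly_nonpos[of u S "card M", OF u_nonpos finM] unfolding l_def by force
  moreover have "c (insert i S) / c {i} \<ge> 0" if "S \<subseteq> M" for S
    using c(3)[OF ins[OF that]] assms(3) by simp
  ultimately have "lc_log M (\<lambda>S. c (insert i S) / c {i}) (f * (1 + u)) (k + l)"
    unfolding lc_log_def using M(1) g geq assms(3) by simp
  then show ?thesis unfolding lc_on_def M_def by blast
qed

section \<open>Log-submodularity by induction through links\<close>

text \<open>By \<open>lc_on_insert_le\<close>, adding one element to a set of coefficient 0 keeps
  the coefficient 0. This settles the cases in which a link cannot be normalised or a factor cannot
  be cancelled.\<close>

lemma lc_on_eq_0_mono: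
  assumes "lc_on N c" "T \<subseteq> S" "S \<subseteq> N" "c T = 0"
  shows "c S = 0"
proof -
  have nonneg: "\<And>S. S \<subseteq> N \<Longrightarrow> c S \<ge> 0" using assms(1) by (simp add: lc_onD)
  have "finite S" using assms(1,3) finite_subset by (auto dest: lc_onD)
  moreover have "c (T \<union> F) = 0" if "finite F" "T \<union> F \<subseteq> N" for F
    using that
  proof (induction F rule: finite_induct)
    case empty
    then show ?case using assms(4) by simp
  next
    case (insert x F)
    show ?case
    proof (cases "x \<in> T")
      case True
      then show ?thesis using insert by (simp add: insert_absorb)
    next
      case False
      then have "c (insert x (T \<union> F)) \<le> c {x} * c (T \<union> F)"
        using insert by (intro lc_on_insert_le[OF assms(1)]) auto
      then show ?thesis using insert nonneg[OF insert.prems] by simp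
    qed
  qed
  ultimately show ?thesis using assms(2,3) by (metis Un_absorb1)
qed

text \<open>The nested case. Each link at an element of \<open>A\<close> removes it from both
  \<open>A\<close> and \<open>B\<close>; once \<open>A\<close> is empty,
  \<open>lc_on_insert_le\<close> applies.\<close>

lemma lc_on_insert_submodular:
  assumes "lc_on N c" "insert i B \<subseteq> N" "i \<notin> B" "A \<subseteq> B"
  shows "c (insert i B) * c A \<le> c B * c (insert i A)"
proof -
  have "finite A" using assms finite_subset[of A N] by (auto dest: lc_onD)
  then show ?thesis using assms
  proof (induction A arbitrary: N c B rule: finite_induct)
    case empty
    then have "c {} = 1" by (simp add: lc_onD)
    then show ?case using lc_on_insert_le[OF empty(1-3)] by (simp add: mult.commute)
  next
    case (insert a A)
    have a: "a \<in> N" "a \<in> B" "a \<noteq> i" using insert.prems by auto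
    show ?case
    proof (cases "c {a} = 0")
      case True
      then have "c (insert i B) = 0" "c B = 0"
        using lc_on_eq_0_mono[OF insert.prems(1), of "{a}"] insert.prems a by auto
      then show ?thesis by simp
    next
      case False
      moreover have "c {a} \<ge> 0" using insert.prems(1) a by (auto dest: lc_onD)
      ultimately have pos: "c {a} > 0" by simp
      \<comment> \<open>The induction hypothesis for the link at \<open>a\<close>; both sides carry
        the same factor \<open>1 / c {a}\<close> squared.\<close>
      have "c (insert a (insert i (B - {a}))) / c {a} * (c (insert a A) / c {a})
          \<le> c (insert a (B - {a})) / c {a} * (c (insert a (insert i A)) / c {a})"
        using insert.prems insert.hyps a
        by (intro insert.IH[OF lc_on_link[OF insert.prems(1) a(1) pos]]) auto
      moreover have "insert a (insert i (B - {a})) = insert i B" "insert a (B - {a}) = B"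
        using a by auto
      ultimately show ?thesis using pos by (simp add: divide_le_cancel insert_commute)
    qed
  qed
qed

text \<open>Linking at an element \<open>i\<close> of the first set gives the inequality with
  \<open>i\<close> adjoined to all four sets. If \<open>i\<close> lies outside \<open>B\<close>, the
  nested case trades \<open>insert i B\<close> for \<open>B\<close> and
  \<open>insert i (A \<inter> B)\<close> for \<open>A \<inter> B\<close>.\<close>

lemma lc_on_submodular:
  assumes "lc_on N c" "A \<subseteq> N" "B \<subseteq> N"
  shows "c (A \<union> B) * c (A \<inter> B) \<le> c A * c B"
proof -
  have "finite A" using assms finite_subset[of A N] by (auto dest: lc_onD)
  then show ?thesis using assms
  proof (induction A arbitrary: N c B rule: finite_induct)
    case empty
    then show ?case by simp
  next
    case (insert i A)
    have i: "i \<in> N" using insert.prems by auto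
    have c: "\<And>S. S \<subseteq> N \<Longrightarrow> c S \<ge> 0" using insert.prems(1) by (auto dest: lc_onD)
    show ?case
    proof (cases "c {i} = 0")
      case True
      then have "c (insert i A \<union> B) = 0" "c (insert i A) = 0"
        using lc_on_eq_0_mono[OF insert.prems(1), of "{i}"] insert.prems i by auto
      then show ?thesis by simp
    next
      case False
      then have pos: "c {i} > 0" using c[of "{i}"] i by simp
      have "c (insert i (A \<union> (B - {i}))) / c {i} * (c (insert i (A \<inter> (B - {i}))) / c {i})
          \<le> c (insert i A) / c {i} * (c (insert i (B - {i})) / c {i})"
        using insert.prems insert.hyps i
        by (intro insert.IH[OF lc_on_link[OF insert.prems(1) i pos]]) auto
      moreover have "insert i (A \<union> (B - {i})) = insert i A \<union> B"
        "insert i (A \<inter> (B - {i})) = insert i (A \<inter> B)" "insert i (B - {i}) = insert i B"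
        using insert.hyps by auto
      ultimately have step: "c (insert i A \<union> B) * c (insert i (A \<inter> B)) \<le> c (insert i A) * c (insert i B)"
        using pos by (simp add: divide_le_cancel)
      show ?thesis
      proof (cases "i \<in> B")
        case True
        then show ?thesis using step by (simp add: insert_absorb)
      next
        case False
        have I: "insert i A \<inter> B = A \<inter> B" using False by auto
        have sub: "c (insert i B) * c (A \<inter> B) \<le> c B * c (insert i (A \<inter> B))"
          using insert.prems False by (intro lc_on_insert_submodular) auto
        show ?thesis
        proof (cases "c (insert i (A \<inter> B)) = 0")
          case True
          have "c (insert i A \<union> B) = 0"
            by (rule lc_on_eq_0_mono[OF insert.prems(1) _ _ True]) (use insert.prems in auto)
          then show ?thesis using insert.prems c by simp
        next
          case False
          have "insert i (A \<inter> B) \<subseteq> N" using insert.prems by auto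
          then have pos': "c (insert i (A \<inter> B)) > 0" using c[of "insert i (A \<inter> B)"] False by simp
          have "A \<inter> B \<subseteq> N" using insert.prems by auto
          then have cI: "c (A \<inter> B) \<ge> 0" by (rule c)
          \<comment> \<open>\<open>step\<close> is multiplied by \<open>c (A \<inter> B)\<close> and
            \<open>sub\<close> by \<open>c (insert i A)\<close>; the positive factor
            \<open>c (insert i (A \<inter> B))\<close> then cancels from the two ends of the
            chain.\<close>
          have "c (insert i A \<union> B) * c (A \<inter> B) * c (insert i (A \<inter> B))
              \<le> c (insert i A) * (c (insert i B) * c (A \<inter> B))"
            using mult_right_mono[OF step cI] by (simp only: mult_ac)
          also have "\<dots> \<le> c (insert i A) * (c B * c (insert i (A \<inter> B)))"
            using sub c[OF insert.prems(2)] by (rule mult_left_mono)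
          finally show ?thesis
            unfolding I using pos' by (simp only: mult.assoc[symmetric] mult_le_cancel_right_pos)
        qed
      qed
    qed
  qed
qed

section \<open>Transfer from polynomials to the quotient algebra\<close>

text \<open>The class map is a ring homomorphism, so it commutes with the sums, products and powers
  that make up the logarithm.\<close>

lemma sqfree_log_class:
  assumes p: "p \<in> carrier (mpoly_ring n)"
  shows "log_poly n (p - 1) \<in> carrier (mpoly_ring n)"
    and "sqfree_log n (sqfree_class n p) = sqfree_class n (log_poly n (p - 1))"
proof -
  interpret R: cring "mpoly_ring n" by (rule mpoly_ring_cring)
  interpret A: cring "sqfree_algebra n" by (rule sqfree_algebra_cring)
  interpret h: ring_hom_cring "mpoly_ring n" "sqfree_algebra n" "sqfree_class n"
    by unfold_locales (rule sqfree_class_hom)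
  have hr: "ring_hom_ring (mpoly_ring n) (sqfree_algebra n) (sqfree_class n)"
    by (rule ring_hom_ringI2[OF R.ring_axioms A.ring_axioms sqfree_class_hom])
  \<comment> \<open>\<open>pow\<close> and \<open>sum\<close> identify the operations of the ring
    record with those of the polynomial type.\<close>
  have pow: "x [^]\<^bsub>mpoly_ring n\<^esub> k = x ^ k" for x and k :: nat
    by (induction k) (simp_all add: mpoly_ring_simps mult.commute)
  have sum: "finsum (mpoly_ring n) g X = sum g X"
    if "g \<in> X \<rightarrow> carrier (mpoly_ring n)" "finite X" for g and X :: "nat set"
    using that(2,1) by (induction X rule: finite_induct) (auto simp: mpoly_ring_simps(4,5))
  have one: "- 1 \<in> carrier (mpoly_ring n)"
    using R.one_closed by (simp add: mpoly_ring_simps in_keys_iff)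
  then have "\<ominus>\<^bsub>mpoly_ring n\<^esub> \<one>\<^bsub>mpoly_ring n\<^esub> = - 1"
    using R.one_closed by (intro R.minus_equality) (auto simp: mpoly_ring_simps)
  then have p1: "p \<ominus>\<^bsub>mpoly_ring n\<^esub> \<one>\<^bsub>mpoly_ring n\<^esub> = p - 1"
    by (simp add: a_minus_def mpoly_ring_simps)
  have p1c: "p - 1 \<in> carrier (mpoly_ring n)"
    using R.minus_closed[OF p R.one_closed] p1 by simp
  let ?t = "\<lambda>k. mpoly_const ((-1) ^ (k + 1) / real k) \<otimes>\<^bsub>mpoly_ring n\<^esub> (p - 1) [^]\<^bsub>mpoly_ring n\<^esub> k"
  have tc: "?t \<in> {1..n} \<rightarrow> carrier (mpoly_ring n)"
    using p1c mpoly_const_closed by (auto intro!: R.m_closed R.nat_pow_closed)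
  have log: "finsum (mpoly_ring n) ?t {1..n} = log_poly n (p - 1)"
    using sum[OF tc] by (simp add: log_poly_def mpoly_ring_simps(2) pow)
  then show "log_poly n (p - 1) \<in> carrier (mpoly_ring n)"
    using R.finsum_closed[OF tc] by simp
  have "sqfree_class n p \<ominus>\<^bsub>sqfree_algebra n\<^esub> \<one>\<^bsub>sqfree_algebra n\<^esub> = sqfree_class n (p - 1)"
    unfolding p1[symmetric] a_minus_def using p by simp
  then have "sqfree_log n (sqfree_class n p) =
      (\<Oplus>\<^bsub>sqfree_algebra n\<^esub>k\<in>{1..n}. sqfree_class n (?t k))"
    unfolding sqfree_log_def sqfree_scale_def
    using p1c mpoly_const_closed by (intro A.finsum_cong') (auto simp: ring_hom_ring.hom_nat_pow[OF hr])
  also have "\<dots> = sqfree_class n (finsum (mpoly_ring n) ?t {1..n})"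
    using h.hom_finsum[OF tc] by (simp add: comp_def)
  finally show "sqfree_log n (sqfree_class n p) = sqfree_class n (log_poly n (p - 1))"
    unfolding log .
qed

text \<open>The witnesses are a representative \<open>p\<close> and
  \<open>log_poly n (p - 1)\<close>. Subsets of \<open>{1..n}\<close> have at most \<open>n\<close>
  elements, so the truncated series satisfies the derivative identity at all of them.\<close>

lemma LC_lc_on:
  assumes "f \<in> LC n"
  shows "lc_on {1..n} (sqfree_coeff n f)"
proof -
  have "f \<in> carrier (sqfree_algebra n)" using assms by (simp add: LC_def)
  then obtain p where p: "p \<in> carrier (mpoly_ring n)" "f = sqfree_class n p"
    using sqfree_class_surj by blast
  have coeff: "sqfree_coeff n f S = sq_coeff p S" if "S \<subseteq> {1..n}" for S
    using sqfree_coeff_class[OF p(1) that] p(2) by (simp add: sq_coeff_def)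
  have cumulant: "cumulant n S f = sq_coeff (log_poly n (p - 1)) S" if "S \<subseteq> {1..n}" for S
    using sqfree_coeff_class[OF sqfree_log_class(1)[OF p(1)] that] sqfree_log_class(2)[OF p(1)] p(2)
    by (simp add: cumulant_def sq_coeff_def)
  have u0: "sq_coeff (p - 1) {} = 0"
    using coeff[of "{}"] assms by (simp add: LC_def sq_coeff_one)
  have "sq_coeff (euler j p) S = sq_coeff (p * euler j (log_poly n (p - 1))) S"
    if S: "S \<subseteq> {1..n}" for j S
  proof -
    have fin: "finite S" and card: "card S \<le> n"
      using S finite_subset[OF S] card_mono[OF _ S] by auto
    have "sq_coeff (euler j (p - 1)) S = sq_coeff (euler j p) S"
      using fin by (auto simp: sq_coeff_euler sq_coeff_one)
    then show ?thesis
      using sq_coeff_euler_log_poly[OF u0 fin card, of j] by simp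
  qed
  moreover have "sq_coeff (log_poly n (p - 1)) S \<le> 0" if "S \<subseteq> {1..n}" "card S \<ge> 2" for S
    unfolding cumulant[OF that(1), symmetric] using assms that unfolding LC_def by blast
  moreover have "sqfree_coeff n f {} = 1" "\<forall>S\<subseteq>{1..n}. sqfree_coeff n f S \<ge> 0"
    using assms unfolding LC_def by blast+
  ultimately have "lc_log {1..n} (sqfree_coeff n f) p (log_poly n (p - 1))"
    unfolding lc_log_def using coeff by (intro conjI allI impI finite_atLeastAtMost) simp_all
  then show ?thesis unfolding lc_on_def by blast
qed

theorem proposition5p7:
  fixes n :: nat and f :: "real_mpoly set" and A B :: "nat set"
  assumes "f \<in> LC n" and "A \<subseteq> {1..n}" and "B \<subseteq> {1..n}"
  shows "sqfree_coeff n f (A \<union> B) * sqfree_coeff n f (A \<inter> B)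
           \<le> sqfree_coeff n f A * sqfree_coeff n f B"
  using lc_on_submodular[OF LC_lc_on[OF assms(1)] assms(2,3)] .

end
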